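(* $\operatorname{spec}(\mathfrak{a}_v)$ is closed under singular limits: if $\lambda$ is a singular cardinal such that $\operatorname{spec}(\mathfrak{a}_v)\cap\lambda$ is unbounded in $\lambda$, then $\lambda\in\operatorname{spec}(\mathfrak{a}_v)$.
   Context: Functions $f,g$ with common domain $A\subseteq\omega$ are eventually different if they agree on only finitely many points of $A$; an eventually different (e.d.) family is one whose distinct members are pairwise eventually different; it is maximal (m.e.d.) if maximal under inclusion among e.d. families of functions $A\to\omega$. For $\mathcal{F}\subseteq\omega^\omega$ and infinite $A\subseteq\omega$ let $\mathcal{F}\restriction A=\{f\restriction A: f\in\mathcal{F}\}$. A family $\mathcal{F}\subseteq\omega^\omega$ is Van Douwen if $\mathcal{F}\restriction A$ is m.e.d. for every infinite $A\subseteq\omega$. $\operatorname{spec}(\mathfrak{a}_v)$ is the set of cardinalities of Van Douwen families. *)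

theory Defs
  imports Main "HOL-Library.FuncSet"
begin

unbundle cardinal_syntax

definition eventually_different :: "nat set \<Rightarrow> (nat \<Rightarrow> nat) \<Rightarrow> (nat \<Rightarrow> nat) \<Rightarrow> bool" where
  "eventually_different A f g \<longleftrightarrow> finite {n \<in> A. f n = g n}"

text \<open>Functions from \<open>A\<close> to \<open>\<omega>\<close> are represented extensionally, so equality in the type
  is equality of functions with domain \<open>A\<close>.\<close>

definition ed_family :: "nat set \<Rightarrow> (nat \<Rightarrow> nat) set \<Rightarrow> bool" where
  "ed_family A F \<longleftrightarrow> F \<subseteq> (A \<rightarrow>\<^sub>E UNIV) \<and> pairwise (eventually_different A) F"

definition med_family :: "nat set \<Rightarrow> (nat \<Rightarrow> nat) set \<Rightarrow> bool" where
  "med_family A F \<longleftrightarrow> ed_family A F \<and> (\<forall>G. ed_family A G \<longrightarrow> F \<subseteq> G \<longrightarrow> G = F)"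

definition restrict_family :: "(nat \<Rightarrow> nat) set \<Rightarrow> nat set \<Rightarrow> (nat \<Rightarrow> nat) set" where
  "restrict_family F A = (\<lambda>f. restrict f A) ` F"

definition Van_Douwen :: "(nat \<Rightarrow> nat) set \<Rightarrow> bool" where
  "Van_Douwen F \<longleftrightarrow> (\<forall>A. infinite A \<longrightarrow> med_family A (restrict_family F A))"

text \<open>Cardinals are represented by cardinal orders, up to order isomorphism, over an
  arbitrary type.\<close>

definition spec_av :: "'a rel set" where
  "spec_av = {r. Card_order r \<and> (\<exists>F. Van_Douwen F \<and> |F| =o r)}"

definition singular_card :: "'a rel \<Rightarrow> bool" where
  "singular_card r \<longleftrightarrow> Card_order r \<and> infinite (Field r) \<and> \<not> regularCard r"

text \<open>An element \<open>a\<close> of the field of a well-order \<open>r\<close> stands for an ordinal below \<open>r\<close>, namely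
  the order type of its strict predecessors.\<close>

definition ordinal_at :: "'a rel \<Rightarrow> 'a \<Rightarrow> 'a rel" where
  "ordinal_at r a = Restr r (underS r a)"

definition spec_av_below :: "'a rel \<Rightarrow> 'a set" where
  "spec_av_below r = {a \<in> Field r. ordinal_at r a \<in> spec_av}"

end

theory Submission
  imports Defs "HOL-Library.Nat_Bijection"
begin

text \<open>Van Douwen families can be multiplied: if \<open>F\<close> is Van Douwen and every \<open>G f\<close> with \<open>f \<in> F\<close>
  is Van Douwen, then so is the family of all functions \<open>n \<mapsto> (f n, g n)\<close> with \<open>f \<in> F\<close>,
  \<open>g \<in> G f\<close>, because an infinite partial function into \<open>\<omega> \<times> \<omega>\<close> meets some \<open>f\<close> on an infinite set
  in its first coordinate, and then some \<open>g \<in> G f\<close> on an infinite subset of that set in its second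
  coordinate. If \<open>\<lambda>\<close> is a singular limit of the spectrum, one takes \<open>|F| < \<lambda>\<close> at least the
  cofinality of \<open>\<lambda>\<close> and lets the \<open>|G f|\<close> run through a cofinal subset of \<open>\<lambda>\<close>; the product then has
  size \<open>\<lambda>\<close>.\<close>

text \<open>If \<open>h\<close> met no member infinitely often on \<open>A\<close>, its restriction
  could be added to the restricted family; maximality would make it a member already, eventually
  different from itself, which is impossible on an infinite set. Conversely, a function in a larger
  e.d. family meets some restricted member infinitely often, hence equals it.\<close>

lemma Van_Douwen_iff:
  "Van_Douwen F \<longleftrightarrow> pairwise (eventually_different UNIV) F \<and>
    (\<forall>A h. infinite A \<longrightarrow> (\<exists>f\<in>F. infinite {n \<in> A. f n = h n}))"
  (is "_ \<longleftrightarrow> ?ed \<and> ?meets")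
proof
  assume F: "Van_Douwen F"
  have "restrict_family F UNIV = F"
    by (simp add: restrict_family_def restrict_def)
  with F have ?ed
    unfolding Van_Douwen_def med_family_def ed_family_def
    by (metis infinite_UNIV_nat)
  moreover have ?meets
  proof (intro allI impI, rule ccontr)
    fix A :: "nat set" and h :: "nat \<Rightarrow> nat"
    assume A: "infinite A" and "\<not> (\<exists>f\<in>F. infinite {n \<in> A. f n = h n})"
    then have fin: "finite {n \<in> A. f n = h n}" if "f \<in> F" for f
      using that by blast
    let ?R = "restrict_family F A" and ?h = "restrict h A"
    have R: "ed_family A ?R" and max: "\<And>G. ed_family A G \<Longrightarrow> ?R \<subseteq> G \<Longrightarrow> G = ?R"
      using F A by (auto simp: Van_Douwen_def med_family_def)
    have h_R: "eventually_different A ?h f \<and> eventually_different A f ?h" if f: "f \<in> ?R" for f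
    proof -
      obtain g where g: "g \<in> F" "f = restrict g A"
        using f unfolding restrict_family_def by blast
      have "{n \<in> A. ?h n = f n} = {n \<in> A. g n = h n}" "{n \<in> A. f n = ?h n} = {n \<in> A. g n = h n}"
        using g by auto
      with fin[OF g(1)] show ?thesis
        by (simp add: eventually_different_def)
    qed
    then have "ed_family A (insert ?h ?R)"
      using R by (auto simp: ed_family_def pairwise_insert)
    then have "?h \<in> ?R"
      using max by blast
    with h_R have "eventually_different A ?h ?h"
      by blast
    with A show False
      by (simp add: eventually_different_def)
  qed
  ultimately show "?ed \<and> ?meets" ..
next
  assume F: "?ed \<and> ?meets"
  show "Van_Douwen F"
    unfolding Van_Douwen_def
  proof (intro allI impI)
    fix A :: "nat set" assume A: "infinite A"
    let ?R = "restrict_family F A"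
    have "pairwise (eventually_different A) ?R"
    proof (rule pairwiseI)
      fix f' g' assume "f' \<in> ?R" "g' \<in> ?R" and ne: "f' \<noteq> g'"
      then obtain f g where fg: "f \<in> F" "g \<in> F" "f' = restrict f A" "g' = restrict g A"
        by (auto simp: restrict_family_def)
      with ne have "f \<noteq> g" by auto
      with F fg have "finite {n. f n = g n}"
        by (auto simp: pairwise_def eventually_different_def)
      then show "eventually_different A f' g'"
        unfolding eventually_different_def by (rule rev_finite_subset) (auto simp: fg)
    qed
    then have ed: "ed_family A ?R"
      by (auto simp: ed_family_def restrict_family_def)
    have "h \<in> ?R" if G: "ed_family A G" "?R \<subseteq> G" and h: "h \<in> G" for G h
    proof -
      obtain f where f: "f \<in> F" "infinite {n \<in> A. f n = h n}"
        using F A by blast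
      have "{n \<in> A. restrict f A n = h n} = {n \<in> A. f n = h n}"
        by auto
      with f have "\<not> eventually_different A (restrict f A) h"
        by (simp add: eventually_different_def)
      moreover have R: "restrict f A \<in> ?R"
        using f by (auto simp: restrict_family_def)
      ultimately have "restrict f A = h"
        using G h by (auto simp: ed_family_def pairwise_def)
      with R show ?thesis by simp
    qed
    with ed show "med_family A ?R"
      by (auto simp: med_family_def)
  qed
qed

text \<open>Coding by a bijection keeps the values in \<open>nat\<close> and lets every function
  split into two coordinates.\<close>

definition pair_fun :: "(nat \<Rightarrow> nat) \<times> (nat \<Rightarrow> nat) \<Rightarrow> nat \<Rightarrow> nat" where
  "pair_fun = (\<lambda>(f, g) n. prod_encode (f n, g n))"

lemma pair_fun_eq_iff: "pair_fun (f, g) n = pair_fun (f', g') n \<longleftrightarrow> f n = f' n \<and> g n = g' n"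
  by (simp add: pair_fun_def)

lemma inj_pair_fun: "inj pair_fun"
  by (auto simp: inj_def fun_eq_iff pair_fun_eq_iff)

lemma Van_Douwen_Sigma:
  assumes F: "Van_Douwen F" and G: "\<And>f. f \<in> F \<Longrightarrow> Van_Douwen (G f)"
  shows "Van_Douwen (pair_fun ` Sigma F G)"
  unfolding Van_Douwen_iff
proof (intro conjI allI impI)
  show "pairwise (eventually_different UNIV) (pair_fun ` Sigma F G)"
  proof (rule pairwiseI)
    fix p q assume "p \<in> pair_fun ` Sigma F G" "q \<in> pair_fun ` Sigma F G" and "p \<noteq> q"
    then obtain f g f' g' where p: "p = pair_fun (f, g)" "f \<in> F" "g \<in> G f"
      and q: "q = pair_fun (f', g')" "f' \<in> F" "g' \<in> G f'" and ne: "f \<noteq> f' \<or> g \<noteq> g'"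
      by auto
    \<comment> \<open>Finite agreement in one coordinate suffices. If \<open>f = f'\<close>, then
      \<open>g\<close> and \<open>g'\<close> are distinct members of the same family
      \<open>G f\<close>; otherwise \<open>F\<close> separates the first coordinates.\<close>
    have "finite {n. f n = f' n} \<or> finite {n. g n = g' n}"
    proof (cases "f = f'")
      case True
      with G[OF p(2)] p q ne show ?thesis
        by (auto simp: Van_Douwen_iff pairwise_def eventually_different_def)
    next
      case False
      with F p q show ?thesis
        by (auto simp: Van_Douwen_iff pairwise_def eventually_different_def)
    qed
    then show "eventually_different UNIV p q"
      by (auto simp: eventually_different_def p q pair_fun_eq_iff)
  qed
next
  fix A :: "nat set" and h :: "nat \<Rightarrow> nat" assume "infinite A"
  define h1 h2 where "h1 = fst \<circ> prod_decode \<circ> h" and "h2 = snd \<circ> prod_decode \<circ> h"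
  have h: "h = pair_fun (h1, h2)"
    by (simp add: h1_def h2_def pair_fun_def)
  obtain f where f: "f \<in> F" "infinite {n \<in> A. f n = h1 n}"
    using F \<open>infinite A\<close> by (auto simp: Van_Douwen_iff)
  then obtain g where g: "g \<in> G f" "infinite {n \<in> {n \<in> A. f n = h1 n}. g n = h2 n}"
    using G unfolding Van_Douwen_iff by metis
  then have "infinite {n \<in> A. pair_fun (f, g) n = h n}"
    by (simp add: h pair_fun_eq_iff conj_assoc)
  with f g show "\<exists>p\<in>pair_fun ` Sigma F G. infinite {n \<in> A. p n = h n}"
    by blast
qed

text \<open>Initial segments are order filters, and on these strict inclusion amounts to
  \<open><o\<close> between the restrictions.\<close>

lemma ordinal_at_ordLess_iff:
  assumes r: "Well_order r" and a: "a \<in> Field r" and b: "b \<in> Field r"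
  shows "ordinal_at r a <o ordinal_at r b \<longleftrightarrow> a \<noteq> b \<and> (a, b) \<in> r"
proof -
  have o: "wo_rel r" using r by (simp add: wo_rel_def)
  have lin: "Linear_order r" using r by (simp add: well_order_on_def)
  have "ordinal_at r a <o ordinal_at r b \<longleftrightarrow> underS r a \<subset> underS r b"
    unfolding ordinal_at_def
    using ofilter_subset_ordLess[OF r] wo_rel.underS_ofilter[OF o] by blast
  also have "\<dots> \<longleftrightarrow> a \<noteq> b \<and> (a, b) \<in> r"
    using underS_incl_iff[OF lin a b] by (auto simp: underS_def)
  finally show ?thesis .
qed

text \<open>Any \<open>r <o lam\<close> is isomorphic to a proper initial segment of
  \<open>lam\<close>, and a cofinal set has an element strictly above the point that cuts it
  off.\<close>

lemma ordinal_at_cofinal: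
  assumes lam: "Well_order lam" and K: "K \<subseteq> Field lam" "cofinal K lam" and r: "r <o lam"
  obtains k where "k \<in> K" "r <o ordinal_at lam k"
proof -
  have "Well_order r"
    using r by (auto simp: ordLess_def)
  then obtain a where a: "a \<in> Field lam" "r =o ordinal_at lam a"
    using ordLess_iff_ordIso_Restr[OF lam] r unfolding ordinal_at_def by blast
  then obtain k where k: "k \<in> K" "a \<noteq> k" "(a, k) \<in> lam"
    using K by (auto simp: cofinal_def)
  then have "ordinal_at lam a <o ordinal_at lam k"
    using ordinal_at_ordLess_iff[OF lam a(1)] K by blast
  with a k that show thesis
    using ordIso_ordLess_trans by blast
qed

theorem theorem4p1:
  fixes lam :: "'a rel"
  assumes "singular_card lam"
    and "cofinal (spec_av_below lam) lam"
  shows "lam \<in> spec_av"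
proof -
  have card: "Card_order lam" and inf: "infinite (Field lam)" and "\<not> regularCard lam"
    using assms(1) by (auto simp: singular_card_def)
  have wo: "Well_order lam"
    using card by (simp add: card_order_on_def)
  let ?S = "spec_av_below lam"
  have S: "?S \<subseteq> Field lam"
    by (auto simp: spec_av_below_def)
  have small: "ordinal_at lam a <o lam" for a
    unfolding ordinal_at_def by (rule underS_Restr_ordLess[OF wo]) (use inf in auto)
  have "\<exists>F. Van_Douwen F \<and> |F| =o ordinal_at lam a" if "a \<in> ?S" for a
    using that by (auto simp: spec_av_below_def spec_av_def)
  then obtain V where V: "\<And>a. a \<in> ?S \<Longrightarrow> Van_Douwen (V a)"
    and card_V: "\<And>a. a \<in> ?S \<Longrightarrow> |V a| =o ordinal_at lam a"
    by metis
  \<comment> \<open>Singularity yields a cofinal set of fewer than \<lambda> points; it need not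
    have least size.\<close>
  obtain K where K: "K \<subseteq> Field lam" "cofinal K lam" and "\<not> |K| =o lam"
    using \<open>\<not> regularCard lam\<close> by (auto simp: regularCard_def)
  moreover have "|K| \<le>o lam"
    by (rule ordLeq_ordIso_trans[OF card_of_mono1[OF K(1)] card_of_Field_ordIso[OF card]])
  ultimately have "|K| <o lam"
    by (simp add: ordLeq_iff_ordLess_or_ordIso)
  then obtain c where c: "c \<in> ?S" "|K| <o ordinal_at lam c"
    using ordinal_at_cofinal[OF wo S assms(2)] by blast
  have "K \<noteq> {}"
    using K inf by (auto simp: cofinal_def)
  have "|K| \<le>o |V c|"
    using ordLess_ordIso_trans[OF c(2) ordIso_symmetric[OF card_V[OF c(1)]]] by (rule ordLess_imp_ordLeq)
  \<comment> \<open>The first factor \<open>V c\<close> is large enough to index \<open>K\<close>,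
    possibly with repetitions.\<close>
  then obtain \<phi> where \<phi>: "\<phi> ` V c = K"
    unfolding card_of_ordLeq2[OF \<open>K \<noteq> {}\<close>, symmetric] by (elim exE)
  \<comment> \<open>Points of \<open>K\<close> need not lie in the spectrum, so each is moved
    strictly up to one that does.\<close>
  have "\<exists>b\<in>?S. k \<noteq> b \<and> (k, b) \<in> lam" if "k \<in> K" for k
    using that K assms(2) by (auto simp: cofinal_def)
  then obtain s where s: "\<And>k. k \<in> K \<Longrightarrow> s k \<in> ?S \<and> k \<noteq> s k \<and> (k, s k) \<in> lam"
    by metis
  define G where "G f = V (s (\<phi> f))" for f
  have sS: "s (\<phi> f) \<in> ?S" if "f \<in> V c" for f
    using that s \<phi> by blast
  let ?T = "pair_fun ` Sigma (V c) G"
  have V_small: "|V a| \<le>o lam" if "a \<in> ?S" for a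
    using ordIso_ordLess_trans[OF card_V[OF that] small] by (rule ordLess_imp_ordLeq)
  have "|Sigma (V c) G| \<le>o lam"
    using V_small c(1) sS by (intro card_of_Sigma_ordLeq_infinite_Field[OF inf card]) (auto simp: G_def)
  then have upper: "|?T| \<le>o lam"
    by (rule ordLeq_transitive[OF card_of_image])
  \<comment> \<open>Otherwise some \<open>k\<close> in \<open>K\<close> exceeds the size of
    \<open>?T\<close>; but the fibre over an \<open>f\<close> with \<open>\<phi> f = k\<close> has
    the size of the ordinal at \<open>s k\<close>, above that at \<open>k\<close>, and embeds into
    \<open>?T\<close>.\<close>
  have "\<not> |?T| <o lam"
  proof
    assume "|?T| <o lam"
    then obtain k where k: "k \<in> K" "|?T| <o ordinal_at lam k"
      using ordinal_at_cofinal[OF wo K] by blast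
    then obtain f where f: "f \<in> V c" "\<phi> f = k"
      using \<phi> by blast
    have "ordinal_at lam k <o ordinal_at lam (s k)"
      using ordinal_at_ordLess_iff[OF wo] s[OF k(1)] k(1) K(1) S by blast
    then have "ordinal_at lam k <o |G f|"
      using ordIso_symmetric[OF card_V[OF sS[OF f(1)]]] unfolding G_def f(2)
      by (rule ordLess_ordIso_trans)
    moreover have "|G f| \<le>o |?T|"
    proof (rule card_of_ordLeqI)
      show "inj_on (\<lambda>g. pair_fun (f, g)) (G f)"
        by (auto intro: inj_onI dest: injD[OF inj_pair_fun])
      show "pair_fun (f, g) \<in> ?T" if "g \<in> G f" for g
        using that f(1) by (intro imageI SigmaI)
    qed
    ultimately have "ordinal_at lam k <o |?T|"
      by (rule ordLess_ordLeq_trans)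
    then show False
      using not_ordLess_ordLeq[OF k(2)] ordLess_imp_ordLeq by blast
  qed
  with upper have "|?T| =o lam"
    by (simp add: ordLeq_iff_ordLess_or_ordIso)
  moreover have "Van_Douwen ?T"
    using c(1) sS by (intro Van_Douwen_Sigma) (auto simp: G_def V)
  ultimately show ?thesis
    using card by (auto simp: spec_av_def)
qed

end
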